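(* Let $c_p, x_*\in\mathbb{R}^n$, $\hat b\in\mathbb{R}$, and let $L_i,U_i\in\mathbb{R}\cup\{\pm\infty\}$ ($i=1,\dots,n$) be such that $L_i\le (x_* )_i\le U_i$ for all $i$ and $c_p^Tx_*<\hat b$. Consider the problem $$\min_{x\in\mathbb{R}^n}\ \tfrac12\|x-x_*\|^2\quad\text{s.t.}\quad L_i\le x_i\le U_i\ (i=1,\dots,n),\quad c_p^Tx\ge \hat b .\qquad (\mathrm{P})$$ Then the box algorithm (described in the context) applied to (P), in finitely many steps, either converges to (i.e. terminates with current iterate $\tilde x^j$ equal to) the solution of (P), or declares the infeasibility of the constraints of (P), in which case those constraints are indeed infeasible.
   Context: Let $B=\{x\in\mathbb{R}^n: L_i\le x_i\le U_i\text{ for all }i\}$, and let $P_B$ denote the Euclidean projection onto $B$. Box algorithm. Set $j=0$ and $\tilde x^0=x_*$. While $c_p^T\tilde x^j<\hat b$, do the following. (1) Define $d\in\mathbb{R}^n$ by $d_i=0$ if [$(c_p)_i>0$ and $\tilde x^j_i=U_i$] or [$(c_p)_i<0$ and $\tilde x^j_i=L_i$], and $d_i=(c_p)_i$ otherwise. (2) If $\|d\|=0$, declare the problem infeasible and stop. (3) Otherwise let $t_2=\dfrac{\hat b-c_p^T\tilde x^j}{c_p^Td}$ and $y^j=\tilde x^j+t_2d$. (4) Set $\tilde x^{j+1}=P_B(y^j)$ and replace $j$ by $j+1$. When the while loop ends, the output is the current $\tilde x^j$. *)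

theory Defs
  imports "HOL-Analysis.Analysis" "HOL-Library.While_Combinator"
begin

definition bound_box :: "ereal ^ 'n \<Rightarrow> ereal ^ 'n \<Rightarrow> (real ^ 'n) set" where
  "bound_box L U = {x. \<forall>i. L $ i \<le> ereal (x $ i) \<and> ereal (x $ i) \<le> U $ i}"

definition feasible_set ::
    "real ^ 'n \<Rightarrow> real \<Rightarrow> ereal ^ 'n \<Rightarrow> ereal ^ 'n \<Rightarrow> (real ^ 'n) set" where
  "feasible_set c b L U = {x \<in> bound_box L U. b \<le> c \<bullet> x}"

definition is_solution ::
    "real ^ 'n \<Rightarrow> real \<Rightarrow> ereal ^ 'n \<Rightarrow> ereal ^ 'n \<Rightarrow> real ^ 'n \<Rightarrow> real ^ 'n \<Rightarrow> bool" where
  "is_solution c b L U x_star x \<longleftrightarrow>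
     is_arg_min (\<lambda>z. 1 / 2 * (norm (z - x_star))\<^sup>2) (\<lambda>z. z \<in> feasible_set c b L U) x"

definition box_direction ::
    "real ^ 'n \<Rightarrow> ereal ^ 'n \<Rightarrow> ereal ^ 'n \<Rightarrow> real ^ 'n \<Rightarrow> real ^ 'n" where
  "box_direction c L U x =
     (\<chi> i. if c $ i > 0 \<and> ereal (x $ i) = U $ i \<or> c $ i < 0 \<and> ereal (x $ i) = L $ i
           then 0 else c $ i)"

(* Infeasible records that the algorithm has declared the problem infeasible and stopped. *)
datatype 'v box_state = Iterate 'v | Infeasible

fun box_continue :: "real ^ 'n \<Rightarrow> real \<Rightarrow> (real ^ 'n) box_state \<Rightarrow> bool" where
  "box_continue c b (Iterate x) \<longleftrightarrow> c \<bullet> x < b"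
| "box_continue c b Infeasible \<longleftrightarrow> False"

(* The step from Infeasible is never taken by the loop below. *)
fun box_step ::
    "real ^ 'n \<Rightarrow> real \<Rightarrow> ereal ^ 'n \<Rightarrow> ereal ^ 'n
      \<Rightarrow> (real ^ 'n) box_state \<Rightarrow> (real ^ 'n) box_state" where
  "box_step c b L U (Iterate x) =
     (let d = box_direction c L U x in
      if norm d = 0 then Infeasible
      else (let t = (b - c \<bullet> x) / (c \<bullet> d);
                y = x + t *\<^sub>R d
            in Iterate (closest_point (bound_box L U) y)))"
| "box_step c b L U Infeasible = Infeasible"

(* The value is None exactly when the while loop runs forever; Some (Iterate x) means that the
   loop ended, after finitely many steps, with output x. *)
definition box_algorithm ::
    "real ^ 'n \<Rightarrow> real \<Rightarrow> ereal ^ 'n \<Rightarrow> ereal ^ 'n \<Rightarrow> real ^ 'n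
      \<Rightarrow> (real ^ 'n) box_state option" where
  "box_algorithm c b L U x_star =
     while_option (box_continue c b) (box_step c b L U) (Iterate x_star)"

end

theory Submission
  imports Defs
begin

text \<open>The box algorithm follows the curve of the points \<open>P\<^sub>B (x\<^sub>* + \<tau> c)\<close>, \<open>\<tau> \<ge> 0\<close>.  By the
  optimality conditions, the solution, if there is one, is the point of this curve on the hyperplane
  \<open>c \<bullet> x = b\<close>, with \<open>\<tau>\<close> as the Lagrange multiplier of the half-space constraint.

  A coordinate in which \<open>x\<close> already sits on the bound towards which \<open>c\<close> points is blocked;
  the direction \<open>d\<close> is \<open>c\<close> with its blocked coordinates removed.  A step of length \<open>t\<close> moves the
  free coordinates by \<open>t c\<close> and then cuts off at the bounds.  Hence it advances along the curve
  from \<open>\<tau>\<close> to \<open>\<tau> + t\<close> (\<open>on_projection_path_step\<close>).  Cutting off only decreases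
  \<open>c \<bullet> x\<close>, so the hyperplane, which the step reaches before the projection, is never overshot:
  a final iterate lies exactly on it and is optimal (\<open>on_projection_path_optimal\<close>).  If the
  new iterate falls short of the hyperplane, some free coordinate has been cut off and has become
  blocked.  Since blocked coordinates stay blocked, this can happen at most \<open>n\<close> times
  (\<open>free_coords_decrease\<close>).  Finally, \<open>d = 0\<close> means that \<open>x\<close> maximises \<open>c \<bullet> x\<close>
  over the box, so that \<open>c \<bullet> x < b\<close> certifies infeasibility.\<close>

section \<open>Projection onto the box\<close>

lemma closed_bound_box:
  fixes L U :: "ereal ^ 'n"
  shows "closed (bound_box L U)"
proof -
  have "bound_box L U =
      (\<Inter>i. {x. L $ i \<le> ereal (x $ i)} \<inter> {x. ereal (x $ i) \<le> U $ i})"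
    by (auto simp: bound_box_def)
  moreover have "closed {x::real^'n. L $ i \<le> ereal (x $ i)}"
    and "closed {x::real^'n. ereal (x $ i) \<le> U $ i}" for i
    by (intro closed_Collect_le continuous_intros)+
  ultimately show ?thesis by (simp add: closed_INT closed_Int)
qed

lemma convex_bound_box:
  fixes L U :: "ereal ^ 'n"
  shows "convex (bound_box L U)"
proof (rule is_interval_convex, unfold is_interval_cart, intro allI ballI impI)
  fix a b x :: "real ^ 'n"
  assume ab: "a \<in> bound_box L U" "b \<in> bound_box L U"
    and x: "\<forall>i. a $ i \<le> x $ i \<and> x $ i \<le> b $ i \<or> b $ i \<le> x $ i \<and> x $ i \<le> a $ i"
  have "L $ i \<le> ereal (x $ i) \<and> ereal (x $ i) \<le> U $ i" for i
  proof -
    have "min (ereal (a $ i)) (ereal (b $ i)) \<le> ereal (x $ i)"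
      "ereal (x $ i) \<le> max (ereal (a $ i)) (ereal (b $ i))"
      using x[rule_format, of i] by (auto simp: min_le_iff_disj le_max_iff_disj)
    moreover have "L $ i \<le> min (ereal (a $ i)) (ereal (b $ i))"
      "max (ereal (a $ i)) (ereal (b $ i)) \<le> U $ i"
      using ab by (auto simp: bound_box_def)
    ultimately show ?thesis by (meson order_trans)
  qed
  then show "x \<in> bound_box L U" by (simp add: bound_box_def)
qed

lemma closest_point_in_bound_box:
  "x \<in> bound_box L U \<Longrightarrow> closest_point (bound_box L U) y \<in> bound_box L U"
  by (rule closest_point_in_set[OF closed_bound_box]) auto

text \<open>The box is a product of intervals, so the variational inequality of the projection may be
  tested with points that differ from the projection in a single coordinate.\<close>

lemma closest_point_bound_box_component:
  fixes x y :: "real ^ 'n"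
  assumes "x \<in> bound_box L U" and "L $ i \<le> ereal v" and "ereal v \<le> U $ i"
  defines "p \<equiv> closest_point (bound_box L U) y"
  shows "(y $ i - p $ i) * (v - p $ i) \<le> 0"
proof -
  define z where "z = p + (v - p $ i) *\<^sub>R axis i 1"
  have z: "z $ j = (if j = i then v else p $ j)" for j
    by (simp add: z_def axis_def)
  have "z \<in> bound_box L U"
    using assms(2,3) closest_point_in_bound_box[OF assms(1), of y]
    by (simp add: bound_box_def z p_def)
  then have "(y - p) \<bullet> (z - p) \<le> 0"
    unfolding p_def by (intro closest_point_dot convex_bound_box closed_bound_box)
  then show ?thesis
    by (simp add: z_def inner_axis mult.commute)
qed

section \<open>One step of the algorithm\<close>

lemma box_direction_cases:
  "box_direction c L U x $ i = 0 \<or> box_direction c L U x $ i = c $ i"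
  by (simp add: box_direction_def)

lemma inner_box_direction:
  "c \<bullet> box_direction c L U x = (norm (box_direction c L U x))\<^sup>2"
  unfolding power2_norm_eq_inner inner_vec_def
  by (rule sum.cong) (auto simp: box_direction_def)

lemma blocked_coordinate_maximal:
  assumes "z \<in> bound_box L U" and "box_direction c L U x $ i = 0"
  shows "c $ i * z $ i \<le> c $ i * x $ i"
proof -
  have "L $ i \<le> ereal (z $ i)" "ereal (z $ i) \<le> U $ i"
    using assms(1) by (auto simp: bound_box_def)
  then show ?thesis
    using assms(2)
    by (auto simp: box_direction_def mult_le_cancel_left split: if_splits)
       (metis ereal_less_eq(3))+
qed

lemma zero_direction_infeasible:
  assumes "box_direction c L U x = 0" and "c \<bullet> x < b"
  shows "feasible_set c b L U = {}"
proof -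
  have "c \<bullet> z \<le> c \<bullet> x" if "z \<in> bound_box L U" for z
    unfolding inner_vec_def using blocked_coordinate_maximal[OF that] assms(1)
    by (intro sum_mono) simp
  then show ?thesis
    using assms(2) by (fastforce simp: feasible_set_def)
qed

context
  fixes c x y p :: "real ^ 'n" and L U :: "ereal ^ 'n" and t :: real
  assumes x: "x \<in> bound_box L U" and t: "t > 0"
  defines "y \<equiv> x + t *\<^sub>R box_direction c L U x"
    and "p \<equiv> closest_point (bound_box L U) y"
begin

text \<open>Since \<open>x\<close> is in the box, projecting \<open>y\<close> never moves a coordinate back beyond \<open>x\<close>.\<close>

lemma projection_between: "(y $ i - p $ i) * (x $ i - p $ i) \<le> 0"
  unfolding p_def by (rule closest_point_bound_box_component[OF x])
    (use x in \<open>auto simp: bound_box_def\<close>)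

lemma step_blocked_fixed:
  assumes "box_direction c L U x $ i = 0"
  shows "p $ i = x $ i"
proof -
  have "(x $ i - p $ i) * (x $ i - p $ i) \<le> 0"
    using projection_between[of i] assms by (simp add: y_def)
  then show ?thesis
    by (metis eq_iff_diff_eq_0 mult_eq_0_iff order_antisym zero_le_square)
qed

lemma step_stays_blocked:
  "box_direction c L U x $ i = 0 \<Longrightarrow> box_direction c L U p $ i = 0"
  using step_blocked_fixed[of i] by (auto simp: box_direction_def split: if_splits)

lemma step_projection_decreases: "c $ i * p $ i \<le> c $ i * y $ i"
proof (cases "box_direction c L U x $ i = 0")
  case True
  then show ?thesis using step_blocked_fixed[OF True] by (simp add: y_def)
next
  case False
  then have "y $ i = x $ i + t * c $ i"
    using box_direction_cases[of c L U x i] by (auto simp: y_def)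
  then show ?thesis
    using projection_between[of i] t
    by (auto simp: mult_le_cancel_left mult_le_0_iff)
       (smt (verit) mult_pos_pos mult_pos_neg)+
qed

text \<open>A coordinate that is cut off lands on the bound, since otherwise some admissible value
  \<open>v\<close> of the coordinate would be closer to \<open>y\<close>.\<close>

lemma step_cut_off_blocked:
  assumes ne: "p $ i \<noteq> y $ i"
  shows "box_direction c L U p $ i = 0"
proof (cases "box_direction c L U x $ i = 0")
  case True
  then show ?thesis by (rule step_stays_blocked)
next
  case False
  then have yx: "y $ i = x $ i + t * c $ i" and c0: "c $ i \<noteq> 0"
    using box_direction_cases[of c L U x i] by (auto simp: y_def)
  have p_box: "L $ i \<le> ereal (p $ i)" "ereal (p $ i) \<le> U $ i"
    using closest_point_in_bound_box[OF x, of y] by (auto simp: bound_box_def p_def)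
  have test: "(y $ i - p $ i) * (v - p $ i) \<le> 0"
    if "L $ i \<le> ereal v" "ereal v \<le> U $ i" for v
    unfolding p_def by (rule closest_point_bound_box_component[OF x that])
  consider "c $ i > 0" | "c $ i < 0" using c0 by linarith
  then show ?thesis
  proof cases
    case 1
    have py: "p $ i < y $ i"
      using step_projection_decreases[of i] ne 1 by (simp add: mult_le_cancel_left)
    have "ereal (p $ i) = U $ i"
    proof (rule ccontr)
      assume "ereal (p $ i) \<noteq> U $ i"
      then obtain v where v: "ereal (p $ i) < ereal v" "ereal v < U $ i"
        using p_box ereal_dense2[of "ereal (p $ i)" "U $ i"] by (auto simp: less_le)
      then have "(y $ i - p $ i) * (v - p $ i) \<le> 0"
        using p_box by (intro test) order+
      then show False using py v by (simp add: mult_le_0_iff)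
    qed
    then show ?thesis using 1 by (simp add: box_direction_def)
  next
    case 2
    have py: "y $ i < p $ i"
      using step_projection_decreases[of i] ne 2 by (simp add: mult_le_cancel_left)
    have "ereal (p $ i) = L $ i"
    proof (rule ccontr)
      assume "ereal (p $ i) \<noteq> L $ i"
      then obtain v where v: "L $ i < ereal v" "ereal v < ereal (p $ i)"
        using p_box ereal_dense2[of "L $ i" "ereal (p $ i)"] by (auto simp: less_le)
      then have "(y $ i - p $ i) * (v - p $ i) \<le> 0"
        using p_box by (intro test) order+
      then show False using py v by (simp add: mult_le_0_iff)
    qed
    then show ?thesis using 2 by (simp add: box_direction_def)
  qed
qed

lemma step_no_overshoot: "c \<bullet> p \<le> c \<bullet> y"
  unfolding inner_vec_def using step_projection_decreases by (intro sum_mono) simp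

text \<open>If no free coordinate became blocked, nothing was cut off, so that \<open>p = y\<close>.\<close>

lemma free_coords_decrease:
  assumes "c \<bullet> p < c \<bullet> y"
  shows "card {i. box_direction c L U p $ i \<noteq> 0} < card {i. box_direction c L U x $ i \<noteq> 0}"
proof -
  obtain i where i: "p $ i \<noteq> y $ i"
    using assms by (metis less_irrefl vec_eq_iff)
  have "box_direction c L U x $ i \<noteq> 0"
    using i step_blocked_fixed[of i] by (auto simp: y_def)
  moreover have "box_direction c L U p $ i = 0"
    by (rule step_cut_off_blocked[OF i])
  ultimately have "{i. box_direction c L U p $ i \<noteq> 0} \<subset> {i. box_direction c L U x $ i \<noteq> 0}"
    using step_stays_blocked by blast
  then show ?thesis by (intro psubset_card_mono) auto
qed

end

section \<open>The projection path\<close>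

text \<open>For \<open>x\<^sub>*\<close> in the box, this is a coordinatewise form of \<open>x = P\<^sub>B (x\<^sub>* + \<tau> c)\<close> for
  some \<open>\<tau> \<ge> 0\<close>: a coordinate of \<open>x\<close> that differs from that of \<open>x\<^sub>* + \<tau> c\<close> is on
  the bound towards which \<open>c\<close> points and has been cut back to it.  The second disjunct cannot be
  \<open>d $ i = 0\<close>, which also holds where \<open>c $ i = 0\<close>; there \<open>x\<close> has to agree with
  \<open>x\<^sub>*\<close>.\<close>

definition on_projection_path ::
    "real ^ 'n \<Rightarrow> ereal ^ 'n \<Rightarrow> ereal ^ 'n \<Rightarrow> real ^ 'n \<Rightarrow> real ^ 'n \<Rightarrow> bool" where
  "on_projection_path c L U x_star x \<longleftrightarrow>
     x \<in> bound_box L U \<and>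
     (\<exists>\<tau>\<ge>0. \<forall>i. (x $ i = x_star $ i + \<tau> * c $ i \<or> box_direction c L U x $ i \<noteq> c $ i) \<and>
                 c $ i * x $ i \<le> c $ i * (x_star $ i + \<tau> * c $ i))"

lemma on_projection_path_start:
  "x \<in> bound_box L U \<Longrightarrow> on_projection_path c L U x x"
  unfolding on_projection_path_def by (intro conjI exI[of _ 0]) auto

lemma on_projection_path_step:
  assumes path: "on_projection_path c L U x_star x" and t: "t > 0"
  defines "p \<equiv> closest_point (bound_box L U) (x + t *\<^sub>R box_direction c L U x)"
  shows "on_projection_path c L U x_star p"
proof -
  let ?d = "box_direction c L U x"
  from path obtain \<tau> where x: "x \<in> bound_box L U" and \<tau>: "\<tau> \<ge> 0"
    and free: "\<And>i. x $ i = x_star $ i + \<tau> * c $ i \<or> ?d $ i \<noteq> c $ i"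
    and cut: "\<And>i. c $ i * x $ i \<le> c $ i * (x_star $ i + \<tau> * c $ i)"
    unfolding on_projection_path_def by blast
  have "(p $ i = x_star $ i + (\<tau> + t) * c $ i \<or> box_direction c L U p $ i \<noteq> c $ i) \<and>
        c $ i * p $ i \<le> c $ i * (x_star $ i + (\<tau> + t) * c $ i)" for i
  proof (cases "?d $ i = 0")
    case True
    have "p $ i = x $ i" "box_direction c L U p $ i = 0"
      using step_blocked_fixed[OF x t True] step_stays_blocked[OF x t True]
      by (simp_all add: p_def)
    moreover have "0 \<le> t * (c $ i * c $ i)" using t by simp
    ultimately show ?thesis
      using cut[of i] free[of i] True by (cases "c $ i = 0") (simp_all add: algebra_simps)
  next
    case False
    then have y: "(x + t *\<^sub>R ?d) $ i = x_star $ i + (\<tau> + t) * c $ i"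
      using free[of i] box_direction_cases[of c L U x i] by (auto simp: algebra_simps)
    have "c $ i \<noteq> 0" using False box_direction_cases[of c L U x i] by auto
    then show ?thesis
      using step_cut_off_blocked[OF x t, of c i] step_projection_decreases[OF x t, of c i]
      unfolding p_def y by auto
  qed
  then show ?thesis
    unfolding on_projection_path_def
    using \<tau> t closest_point_in_bound_box[OF x]
    by (intro conjI exI[of _ "\<tau> + t"]) (auto simp: p_def)
qed

text \<open>The vector \<open>x\<^sub>* + \<tau> c - x\<close> is an outer normal of the box at \<open>x\<close>, and \<open>-\<tau> c\<close>
  points away from the half-space \<open>b \<le> c \<bullet> z\<close>.  Their sum is \<open>x\<^sub>* - x\<close>.  This is the
  first-order optimality condition.\<close>

lemma on_projection_path_obtuse:
  assumes path: "on_projection_path c L U x_star x"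
    and z: "z \<in> feasible_set c b L U" and xb: "c \<bullet> x \<le> b"
  shows "(x_star - x) \<bullet> (z - x) \<le> 0"
proof -
  from path obtain \<tau> where \<tau>: "\<tau> \<ge> 0"
    and free: "\<And>i. x $ i = x_star $ i + \<tau> * c $ i \<or> box_direction c L U x $ i \<noteq> c $ i"
    and cut: "\<And>i. c $ i * x $ i \<le> c $ i * (x_star $ i + \<tau> * c $ i)"
    unfolding on_projection_path_def by blast
  have zB: "z \<in> bound_box L U" and zb: "b \<le> c \<bullet> z"
    using z by (auto simp: feasible_set_def)
  have "(x_star + \<tau> *\<^sub>R c - x) $ i * (z - x) $ i \<le> 0" for i
  proof (cases "x $ i = x_star $ i + \<tau> * c $ i")
    case False
    then have "box_direction c L U x $ i \<noteq> c $ i" using free[of i] by blast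
    then have blocked: "box_direction c L U x $ i = 0" and "c $ i \<noteq> 0"
      using box_direction_cases[of c L U x i] by auto
    then show ?thesis
      using cut[of i] blocked_coordinate_maximal[OF zB blocked]
      by (auto simp: mult_le_cancel_left mult_le_0_iff)
  qed simp
  then have "(x_star + \<tau> *\<^sub>R c - x) \<bullet> (z - x) \<le> 0"
    unfolding inner_vec_def by (intro sum_nonpos) simp
  moreover have "0 \<le> \<tau> * (c \<bullet> (z - x))"
    using \<tau> zb xb by (intro mult_nonneg_nonneg) (auto simp: inner_diff_right)
  ultimately show ?thesis
    by (simp add: inner_add_left inner_diff_left)
qed

text \<open>Expanding the square around \<open>x\<close>, the first-order condition shows that a feasible point
  \<open>w\<close> exceeds the optimal squared distance by at least \<open>(norm (w - x))\<^sup>2\<close>, which gives both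
  optimality and uniqueness.\<close>

lemma on_projection_path_optimal:
  assumes path: "on_projection_path c L U x_star x" and cx: "c \<bullet> x = b"
  shows "is_solution c b L U x_star z \<longleftrightarrow> z = x"
proof -
  have feas: "x \<in> feasible_set c b L U"
    using path cx by (simp add: feasible_set_def on_projection_path_def)
  have gap: "(norm (x - x_star))\<^sup>2 + (norm (w - x))\<^sup>2 \<le> (norm (w - x_star))\<^sup>2"
    if "w \<in> feasible_set c b L U" for w
    using on_projection_path_obtuse[OF path that] cx
    by (simp add: power2_norm_eq_inner algebra_simps inner_commute)
  show ?thesis
  proof
    assume "is_solution c b L U x_star z"
    then have z: "z \<in> feasible_set c b L U"
      and "(norm (z - x_star))\<^sup>2 \<le> (norm (x - x_star))\<^sup>2"
      using feas by (auto simp: is_solution_def is_arg_min_def not_less)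
    then have "(norm (z - x))\<^sup>2 \<le> 0"
      using gap[OF z] by linarith
    then show "z = x" by simp
  next
    assume "z = x"
    moreover have "(norm (x - x_star))\<^sup>2 \<le> (norm (w - x_star))\<^sup>2"
      if "w \<in> feasible_set c b L U" for w
      using gap[OF that] zero_le_power2[of "norm (w - x)"] by linarith
    ultimately show "is_solution c b L U x_star z"
      using feas by (auto simp: is_solution_def is_arg_min_def not_less)
  qed
qed

section \<open>Termination and correctness\<close>

primrec box_invariant ::
    "real ^ 'n \<Rightarrow> real \<Rightarrow> ereal ^ 'n \<Rightarrow> ereal ^ 'n \<Rightarrow> real ^ 'n
      \<Rightarrow> (real ^ 'n) box_state \<Rightarrow> bool" where
  "box_invariant c b L U x_star (Iterate x) \<longleftrightarrow> on_projection_path c L U x_star x \<and> c \<bullet> x \<le> b"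
| "box_invariant c b L U x_star Infeasible \<longleftrightarrow> feasible_set c b L U = {}"

text \<open>The step that reaches the hyperplane need not block a coordinate, and the step that detects
  infeasibility starts without free coordinates; hence the value 0 for final states and
  the successor for the others.\<close>

primrec box_measure ::
    "real ^ 'n \<Rightarrow> real \<Rightarrow> ereal ^ 'n \<Rightarrow> ereal ^ 'n \<Rightarrow> (real ^ 'n) box_state \<Rightarrow> nat" where
  "box_measure c b L U (Iterate x) =
     (if c \<bullet> x < b then Suc (card {i. box_direction c L U x $ i \<noteq> 0}) else 0)"
| "box_measure c b L U Infeasible = 0"

lemma box_step_progress:
  assumes inv: "box_invariant c b L U x_star s" and cont: "box_continue c b s"
  shows "box_invariant c b L U x_star (box_step c b L U s) \<and>
         box_measure c b L U (box_step c b L U s) < box_measure c b L U s"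
proof (cases s)
  case (Iterate x)
  let ?d = "box_direction c L U x"
  have path: "on_projection_path c L U x_star x" and cx: "c \<bullet> x < b"
    using inv cont Iterate by auto
  have x: "x \<in> bound_box L U" using path by (simp add: on_projection_path_def)
  show ?thesis
  proof (cases "?d = 0")
    case True
    then show ?thesis using Iterate cx zero_direction_infeasible[OF True cx] by simp
  next
    case False
    define t where "t = (b - c \<bullet> x) / (c \<bullet> ?d)"
    define p where "p = closest_point (bound_box L U) (x + t *\<^sub>R ?d)"
    have cd: "c \<bullet> ?d > 0" using False by (simp add: inner_box_direction)
    then have t: "t > 0" using cx by (simp add: t_def)
    have cy: "c \<bullet> (x + t *\<^sub>R ?d) = b"
      using cd by (simp add: t_def inner_add_right)
    have step: "box_step c b L U s = Iterate p"
      using False Iterate by (simp add: t_def p_def Let_def)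
    have "on_projection_path c L U x_star p"
      unfolding p_def by (rule on_projection_path_step[OF path t])
    moreover have "c \<bullet> p \<le> b"
      using step_no_overshoot[OF x t, of c] cy by (simp add: p_def)
    moreover have "card {i. box_direction c L U p $ i \<noteq> 0} < card {i. ?d $ i \<noteq> 0}"
      if "c \<bullet> p < b"
      using free_coords_decrease[OF x t, of c] that cy by (simp add: p_def)
    ultimately show ?thesis using step Iterate cx by simp
  qed
next
  case Infeasible
  then show ?thesis using cont by simp
qed

theorem proposition5p2:
  fixes c_p x_star :: "real ^ 'n" and b_hat :: real and L U :: "ereal ^ 'n"
  assumes "\<forall>i. L $ i \<le> ereal (x_star $ i) \<and> ereal (x_star $ i) \<le> U $ i"
    and "c_p \<bullet> x_star < b_hat"
  shows "(\<exists>x. box_algorithm c_p b_hat L U x_star = Some (Iterate x) \<and>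
              (\<forall>z. is_solution c_p b_hat L U x_star z \<longleftrightarrow> z = x)) \<or>
         (box_algorithm c_p b_hat L U x_star = Some Infeasible \<and>
              feasible_set c_p b_hat L U = {})"
proof -
  have "x_star \<in> bound_box L U" using assms(1) by (simp add: bound_box_def)
  then have start: "box_invariant c_p b_hat L U x_star (Iterate x_star)"
    using assms(2) by (simp add: on_projection_path_start)
  have "\<exists>s. box_algorithm c_p b_hat L U x_star = Some s"
    unfolding box_algorithm_def
    by (rule measure_while_option_Some[where P = "box_invariant c_p b_hat L U x_star"
        and f = "box_measure c_p b_hat L U", OF box_step_progress start])
  then obtain s where run: "box_algorithm c_p b_hat L U x_star = Some s" by blast
  have inv: "box_invariant c_p b_hat L U x_star s"
    by (rule while_option_rule[where P = "box_invariant c_p b_hat L U x_star",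
        OF conjunct1[OF box_step_progress] run[unfolded box_algorithm_def] start])
  have stop: "\<not> box_continue c_p b_hat s"
    by (rule while_option_stop[OF run[unfolded box_algorithm_def]])
  show ?thesis
  proof (cases s)
    case (Iterate x)
    then have path: "on_projection_path c_p L U x_star x" and eq: "c_p \<bullet> x = b_hat"
      using inv stop by auto
    have "\<forall>z. is_solution c_p b_hat L U x_star z \<longleftrightarrow> z = x"
      using on_projection_path_optimal[OF path eq] by simp
    then show ?thesis using run Iterate by simp
  next
    case Infeasible
    then show ?thesis using run inv by simp
  qed
qed

end
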